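(* If $G$ and $H$ are finite graphs, then $B(G\square H) \leq B(G) + B(H) + c(G\square H) - 1$.
   Context: The Cartesian product $G\square H$ has vertex set $V(G)\times V(H)$, with $(u,v)$ adjacent to $(x,y)$ iff either $ux\in E(G)$ and $v=y$, or $u=x$ and $vy\in E(H)$. The cop number $c(G)$ is the minimum number of cops that guarantees capture in the classical Cops and Robber game (cops placed first, then robber; alternating turns, cops first; each token moves to an adjacent vertex or stays; cops win if some cop occupies the robber's vertex). Bodyguards and Presidents is a two-player game on a finite simple graph $G$. One player controls a set of tokens called bodyguards, the other a single token called the president. First all bodyguards are placed on vertices (several may share a vertex), then the president is placed. The players then alternate turns, bodyguards first; on a player's turn, each token they control either moves to an adjacent vertex or stays put. The president is surrounded if every vertex of the open neighbourhood of the president's vertex is occupied by a bodyguard. The bodyguards win if there is a finite time after which, at the end of every bodyguard turn, the president is surrounded; otherwise the president wins. The bodyguard number $B(G)$ is the minimum number of bodyguards that guarantees a win for the bodyguards on $G$ (with $B(G)=0$ for the edgeless graph).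
   Formalization: G and H are assumed connected (and nonempty). Without this the bound fails: for G the path on three vertices and H two isolated vertices, B(G)=2, B(H)=0, c(G□H)=2, but B(G□H)=4 > 3. *)

theory Defs
  imports "Graph_Theory.Graph_Theory"
begin

text \<open>
  A finite simple graph is a \<open>pair_graph\<close>: finite vertex set, symmetric and irreflexive arc set.
  The bound on the bodyguard number of a product is for connected graphs, as is usual for pursuit
  games. It fails for disconnected ones: if \<open>G\<close> is the path on three vertices and \<open>H\<close> consists of two
  isolated vertices, then \<open>B(G) = 2\<close>, \<open>B(H) = 0\<close>, \<open>c(G \<box> H) = 2\<close>, but \<open>B(G \<box> H) = 4\<close>.
\<close>

definition cartesian_product ::
  "'a pair_pre_digraph \<Rightarrow> 'b pair_pre_digraph \<Rightarrow> ('a \<times> 'b) pair_pre_digraph" (infixr \<open>\<box>\<close> 80)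
where
  "G \<box> H = \<lparr> pverts = pverts G \<times> pverts H,
             parcs = {((u, v), (x, y)) | u v x y.
               u \<in> pverts G \<and> v \<in> pverts H \<and> x \<in> pverts G \<and> y \<in> pverts H \<and>
               ((u, x) \<in> parcs G \<and> v = y \<or> u = x \<and> (v, y) \<in> parcs H)} \<rparr>"

definition lazy_step :: "'a pair_pre_digraph \<Rightarrow> 'a \<Rightarrow> 'a \<Rightarrow> bool" where
  "lazy_step G u v \<longleftrightarrow> u \<in> pverts G \<and> v \<in> pverts G \<and> (u = v \<or> (u, v) \<in> parcs G)"

text \<open>
  A play of the lone token (president, robber): \<open>p 0\<close> is its initial placement and \<open>p t\<close> its
  position after its \<open>t\<close>-th turn.
\<close>

definition lazy_walk :: "'a pair_pre_digraph \<Rightarrow> (nat \<Rightarrow> 'a) \<Rightarrow> bool" where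
  "lazy_walk G p \<longleftrightarrow> p 0 \<in> pverts G \<and> (\<forall>t. lazy_step G (p t) (p (Suc t)))"

text \<open>
  A strategy \<open>s\<close> for the player with \<open>k\<close> tokens (bodyguards, cops) maps the history of positions of
  the lone token to the positions of the tokens \<open>i < k\<close>: \<open>s []\<close> is the initial placement, chosen
  before the lone token is placed, and \<open>s [p 0, \<dots>, p t]\<close> is the position at the end of the
  \<open>(t + 1)\<close>-st turn, which comes before the lone token moves to \<open>p (t + 1)\<close>. The tokens' own earlier
  positions are determined by this history, so nothing is lost by leaving them out.
\<close>

definition team_position :: "('a list \<Rightarrow> nat \<Rightarrow> 'a) \<Rightarrow> (nat \<Rightarrow> 'a) \<Rightarrow> nat \<Rightarrow> nat \<Rightarrow> 'a" where
  "team_position s p n i = s (map p [0..<n]) i"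

definition team_strategy :: "'a pair_pre_digraph \<Rightarrow> nat \<Rightarrow> ('a list \<Rightarrow> nat \<Rightarrow> 'a) \<Rightarrow> bool" where
  "team_strategy G k s \<longleftrightarrow>
     (\<forall>i<k. s [] i \<in> pverts G) \<and>
     (\<forall>p. lazy_walk G p \<longrightarrow>
       (\<forall>n. \<forall>i<k. lazy_step G (team_position s p n i) (team_position s p (Suc n) i)))"

definition surrounded :: "'a pair_pre_digraph \<Rightarrow> nat \<Rightarrow> (nat \<Rightarrow> 'a) \<Rightarrow> 'a \<Rightarrow> bool" where
  "surrounded G k b u \<longleftrightarrow> (\<forall>v. (u, v) \<in> parcs G \<longrightarrow> (\<exists>i<k. b i = v))"

definition bodyguards_win :: "'a pair_pre_digraph \<Rightarrow> nat \<Rightarrow> bool" where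
  "bodyguards_win G k \<longleftrightarrow>
     (\<exists>s. team_strategy G k s \<and>
       (\<forall>p. lazy_walk G p \<longrightarrow>
         (\<exists>T. \<forall>t\<ge>T. surrounded G k (team_position s p (Suc t)) (p t))))"

definition bodyguard_number :: "'a pair_pre_digraph \<Rightarrow> nat" where
  "bodyguard_number G = (LEAST k. bodyguards_win G k)"

text \<open>
  The two disjuncts are capture at the end of a placement or move of the robber, and at the end of a
  turn of the cops.
\<close>

definition cops_win :: "'a pair_pre_digraph \<Rightarrow> nat \<Rightarrow> bool" where
  "cops_win G k \<longleftrightarrow>
     (\<exists>s. team_strategy G k s \<and>
       (\<forall>p. lazy_walk G p \<longrightarrow>
         (\<exists>t. \<exists>i<k. team_position s p t i = p t \<or> team_position s p (Suc t) i = p t)))"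

definition cop_number :: "'a pair_pre_digraph \<Rightarrow> nat" where
  "cop_number G = (LEAST k. cops_win G k)"

text \<open>
  On a finite graph one token per vertex wins either game, so both minima are over nonempty sets.
\<close>

lemma team_position_const: "team_position (\<lambda>_. f) p n = f"
  by (simp add: team_position_def fun_eq_iff)

lemma team_strategy_const:
  assumes "f ` {..<k} \<subseteq> pverts G"
  shows "team_strategy G k (\<lambda>_. f)"
  using assms by (auto simp: team_strategy_def team_position_const lazy_step_def)

lemma bodyguards_win_card:
  assumes "pair_graph G"
  shows "bodyguards_win G (card (pverts G))"
proof -
  interpret pair_graph G by fact
  obtain f where f: "f ` {..<card (pverts G)} = pverts G"
    using ex_bij_betw_nat_finite[OF pair_finite_verts] by (auto simp: bij_betw_def atLeast0LessThan)
  have "surrounded G (card (pverts G)) f u" for u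
    unfolding surrounded_def using f in_arcsD2 by (metis imageE lessThan_iff)
  then show ?thesis
    unfolding bodyguards_win_def using f
    by (intro exI[of _ "\<lambda>_. f"]) (simp add: team_strategy_const team_position_const)
qed

lemma cops_win_card:
  assumes "pair_graph G"
  shows "cops_win G (card (pverts G))"
proof -
  interpret pair_graph G by fact
  obtain f where f: "f ` {..<card (pverts G)} = pverts G"
    using ex_bij_betw_nat_finite[OF pair_finite_verts] by (auto simp: bij_betw_def atLeast0LessThan)
  have "\<exists>i<card (pverts G). f i = p 0" if "lazy_walk G p" for p
    using that f unfolding lazy_walk_def by (metis imageE lessThan_iff)
  then show ?thesis
    unfolding cops_win_def using f
    by (intro exI[of _ "\<lambda>_. f"]) (simp add: team_strategy_const team_position_const, blast)
qed

end

theory Submission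
  imports Defs "HOL-Library.Sublist"
begin

text \<open>
  A winning team on a connected graph can be assumed to surround the president from its first reply
  on, if its initial position may depend on the president's: some history is secure, in that the
  president stays surrounded whatever he does, and it can be continued to end at any prescribed
  vertex. Imagine such teams of \<open>B(G)\<close> and \<open>B(H)\<close> virtual guards in the copies of \<open>G\<close> and \<open>H\<close> through
  the president in \<open>G \<box> H\<close>. Together they always surround him, and each virtual guard walks along
  edges of \<open>G \<box> H\<close>. So \<open>c(G \<box> H)\<close> real bodyguards, playing as cops with a virtual guard as
  robber, can catch it, after which one of them can follow it forever. The virtual guards are caught
  one after the other; when the last one is hunted, \<open>B(G) + B(H) - 1\<close> bodyguards are following
  others.
\<close>

section \<open>Lazy walks\<close>

text \<open>Finite counterpart of \<open>lazy_walk\<close>: the histories fed to a strategy. The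
  empty list counts, as \<open>s []\<close> is the initial placement.\<close>

definition lazy_path :: "'a pair_pre_digraph \<Rightarrow> 'a list \<Rightarrow> bool" where
  "lazy_path G xs \<longleftrightarrow> set xs \<subseteq> pverts G \<and> successively (lazy_step G) xs"

definition lazy_connected :: "'a pair_pre_digraph \<Rightarrow> bool" where
  "lazy_connected G \<longleftrightarrow>
     pverts G \<noteq> {} \<and> (\<forall>u\<in>pverts G. \<forall>v\<in>pverts G. (lazy_step G)\<^sup>*\<^sup>* u v)"

lemma lazy_step_refl: "u \<in> pverts G \<Longrightarrow> lazy_step G u u"
  by (simp add: lazy_step_def)

lemma lazy_stepD2: "lazy_step G u v \<Longrightarrow> v \<in> pverts G"
  by (simp add: lazy_step_def)

lemma lazy_path_Nil: "lazy_path G []"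
  by (simp add: lazy_path_def)

lemma lazy_path_snoc:
  "lazy_path G (xs @ [v]) \<longleftrightarrow>
     lazy_path G xs \<and> v \<in> pverts G \<and> (xs \<noteq> [] \<longrightarrow> lazy_step G (last xs) v)"
  by (auto simp: lazy_path_def successively_append_iff)

text \<open>Winning conditions speak only about infinite plays. The arguments by contradiction below
  build ever longer bad histories and apply the condition to their limit.\<close>

lemma lazy_path_prefixes_imp_lazy_walk:
  assumes path: "\<And>n. lazy_path G (H n)"
    and prefix: "\<And>n. strict_prefix (H n) (H (Suc n))"
  obtains p where "lazy_walk G p" "\<And>n. map p [0..<length (H n)] = H n"
proof -
  have len: "n \<le> length (H n)" for n
  proof (induction n)
    case (Suc n)
    then show ?case using prefix_length_less[OF prefix[of n]] by simp
  qed simp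
  have mono: "prefix (H m) (H n)" if "m \<le> n" for m n
    using that
  proof (induction n rule: dec_induct)
    case (step n)
    then show ?case using prefix[of n] prefix_order.order_trans by (metis strict_prefix_def)
  qed simp
  \<comment> \<open>\<open>H (Suc t)\<close> has length at least \<open>Suc t\<close>, so its entry
    \<open>t\<close> exists, and every later history agrees with it there.\<close>
  define p where "p t = H (Suc t) ! t" for t
  have nth: "p t = H n ! t" if "t < length (H n)" for t n
  proof -
    have "t < length (H (Suc t))" using len[of "Suc t"] by simp
    then show ?thesis
      using that mono[of n "Suc t"] mono[of "Suc t" n] unfolding p_def prefix_def
      by (metis nat_le_linear nth_append)
  qed
  have map_p: "map p [0..<length (H n)] = H n" for n
    by (rule nth_equalityI) (use nth in auto)
  have "lazy_path G (map p [0..<n])" for n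
  proof -
    have "map p [0..<n] = take n (H n)"
      using map_p[of n] len[of n] by (metis add_0 take_map take_upt)
    then have "H n = map p [0..<n] @ drop n (H n)" by simp
    then show ?thesis
      using path[of n] unfolding lazy_path_def
      by (metis le_sup_iff set_append successively_append_iff)
  qed
  from this[of "Suc (Suc t)" for t] this[of 1]
  have "lazy_walk G p"
    by (auto simp: lazy_walk_def lazy_path_def successively_append_iff)
  with map_p that show ?thesis by blast
qed

text \<open>The lone token stops at its last vertex. This carries over to finite histories the step
  rule that \<open>team_strategy\<close> imposes along infinite plays.\<close>

lemma lazy_path_extends_to_lazy_walk:
  assumes "lazy_path G xs" "xs \<noteq> []"
  obtains p where "lazy_walk G p" "map p [0..<length xs] = xs"
proof -
  define H where "H n = xs @ replicate n (last xs)" for n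
  have snoc: "H (Suc n) = H n @ [last xs]" for n
    by (simp add: H_def replicate_append_same)
  have last: "last (H n) = last xs" for n
    by (induction n) (auto simp: snoc, simp add: H_def)
  have path_last: "last xs \<in> pverts G" using assms by (auto simp: lazy_path_def)
  have "lazy_path G (H n)" for n
  proof (induction n)
    case 0
    then show ?case using assms by (simp add: H_def)
  next
    case (Suc n)
    then show ?case
      using assms(2) path_last by (auto simp: snoc lazy_path_snoc last intro: lazy_step_refl)
  qed
  moreover have "strict_prefix (H n) (H (Suc n))" for n
    by (simp add: snoc strict_prefix_def)
  ultimately obtain p where "lazy_walk G p" "\<And>n. map p [0..<length (H n)] = H n"
    using lazy_path_prefixes_imp_lazy_walk by metis
  from this(1) this(2)[of 0] show ?thesis using that by (simp add: H_def)
qed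

lemma team_strategy_lazy_step:
  assumes "team_strategy G k s" "lazy_path G (h @ [v])" "i < k"
  shows "lazy_step G (s h i) (s (h @ [v]) i)"
proof -
  obtain p where p: "lazy_walk G p" "map p [0..<length (h @ [v])] = h @ [v]"
    using lazy_path_extends_to_lazy_walk[OF assms(2)] by blast
  then have "map p [0..<length h] = h" by simp
  with p assms show ?thesis
    unfolding team_strategy_def team_position_def by (metis length_append_singleton)
qed

lemma team_strategy_in_verts:
  assumes "team_strategy G k s" "lazy_path G h" "i < k"
  shows "s h i \<in> pverts G"
  using assms(2)
proof (cases h rule: rev_cases)
  case Nil
  then show ?thesis using assms unfolding team_strategy_def by simp
next
  case (snoc h' v)
  then show ?thesis
    using team_strategy_lazy_step[OF assms(1) _ assms(3), of h' v] assms(2)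
    by (auto dest: lazy_stepD2)
qed

text \<open>A token arriving early waits at \<open>v\<close>; this pads the walks of several tokens
  to a common length.\<close>

lemma relpowp_lazy_step_mono:
  assumes "(lazy_step G ^^ m) u v" "m \<le> n" "v \<in> pverts G"
  shows "(lazy_step G ^^ n) u v"
  using assms(2)
proof (induction n rule: dec_induct)
  case base
  then show ?case using assms by simp
next
  case (step n)
  then show ?case using lazy_step_refl[OF assms(3)] by auto
qed

lemma connected_imp_lazy_connected:
  assumes "pair_graph G" "connected (with_proj G)"
  shows "lazy_connected G"
proof -
  interpret pair_graph G by fact
  have "strongly_connected (with_proj G)"
    using symmetric_connected_imp_strongly_connected[OF pair_sym_arcs assms(2)] .
  then have ne: "pverts G \<noteq> {}"
    and reach: "u \<in> pverts G \<Longrightarrow> v \<in> pverts G \<Longrightarrow> u \<rightarrow>\<^sup>*\<^bsub>with_proj G\<^esub> v" for u v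
    by (auto simp: strongly_connected_def)
  have "(lazy_step G)\<^sup>*\<^sup>* u v" if "u \<rightarrow>\<^sup>*\<^bsub>with_proj G\<^esub> v" for u v
    using that
  proof (induction rule: reachable_induct)
    case (step x y)
    then have "lazy_step G x y" by (auto simp: lazy_step_def in_arcsD1 in_arcsD2)
    with step show ?case by simp
  qed simp
  with ne reach show ?thesis by (auto simp: lazy_connected_def)
qed

section \<open>Guarding relations\<close>

text \<open>The first clause places the guards after the president, against the rules, so these
  guards can only be imagined. A relation is needed because the same president vertex may go with
  different placements, depending on the history.\<close>

definition guarding :: "'a pair_pre_digraph \<Rightarrow> nat \<Rightarrow> ('a \<times> (nat \<Rightarrow> 'a)) set \<Rightarrow> bool" where
  "guarding G k S \<longleftrightarrow>
     (\<forall>u\<in>pverts G. \<exists>b. (u, b) \<in> S) \<and>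
     (\<forall>u b. (u, b) \<in> S \<longrightarrow>
        surrounded G k b u \<and> (\<forall>i<k. b i \<in> pverts G) \<and>
        (\<forall>v. lazy_step G u v \<longrightarrow> (\<exists>b'. (v, b') \<in> S \<and> (\<forall>i<k. lazy_step G (b i) (b' i)))))"

text \<open>
  Some history leaves the president surrounded after every continuation: otherwise every history
  could be extended to a bad one again and again, and the limit play would defeat the bodyguards.
\<close>

lemma bodyguards_win_imp_secure_history:
  assumes s: "team_strategy G k s"
    and win: "\<And>p. lazy_walk G p \<Longrightarrow> \<exists>T. \<forall>t\<ge>T. surrounded G k (team_position s p (Suc t)) (p t)"
    and ne: "pverts G \<noteq> {}"
  obtains h where "lazy_path G h" "h \<noteq> []"
    "\<And>e. lazy_path G (h @ e) \<Longrightarrow> surrounded G k (s (h @ e)) (last (h @ e))"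
proof (rule ccontr)
  assume contra: "\<not> thesis"
  note secureI = that
  have bad: "\<exists>e. lazy_path G (h @ e) \<and> \<not> surrounded G k (s (h @ e)) (last (h @ e))"
    if "lazy_path G h" "h \<noteq> []" for h
    using contra secureI[of h] that by blast
  let ?P = "\<lambda>h. lazy_path G h \<and> h \<noteq> [] \<and> \<not> surrounded G k (s h) (last h)"
  obtain u where "u \<in> pverts G" using ne by blast
  then have "lazy_path G [u]" by (simp add: lazy_path_def)
  then obtain e where "lazy_path G ([u] @ e)" "\<not> surrounded G k (s ([u] @ e)) (last ([u] @ e))"
    using bad by blast
  then have 1: "\<exists>h. ?P h" by (intro exI[of _ "[u] @ e"]) simp
  have 2: "\<exists>h'. ?P h' \<and> strict_prefix h h'" if "?P h" for h
  proof -
    \<comment> \<open>Repeating the last vertex makes the next bad history strictly longer even when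
      the extension \<open>e\<close> is empty.\<close>
    have path: "lazy_path G (h @ [last h])"
    proof -
      have "last h \<in> pverts G" using that by (auto simp: lazy_path_def)
      with that show ?thesis by (simp add: lazy_path_snoc lazy_step_refl)
    qed
    have "h @ [last h] \<noteq> []" by simp
    from bad[OF path this] obtain e where
      "lazy_path G ((h @ [last h]) @ e)"
      "\<not> surrounded G k (s ((h @ [last h]) @ e)) (last ((h @ [last h]) @ e))"
      by blast
    then show ?thesis
      by (intro exI[of _ "(h @ [last h]) @ e"]) (auto simp: strict_prefix_def)
  qed
  obtain H where H: "\<And>n. ?P (H n)" "\<And>n. strict_prefix (H n) (H (Suc n))"
    using dependent_nat_choice[of "\<lambda>_. ?P" "\<lambda>_. strict_prefix"] 1 2 by metis
  obtain p where p: "lazy_walk G p" "\<And>n. map p [0..<length (H n)] = H n"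
    using lazy_path_prefixes_imp_lazy_walk[of G H] H by blast
  obtain T where T: "\<And>t. t \<ge> T \<Longrightarrow> surrounded G k (team_position s p (Suc t)) (p t)"
    using win[OF p(1)] by blast
  have len: "n < length (H n)" for n
  proof (induction n)
    case (Suc n)
    then show ?case using prefix_length_less[OF H(2)[of n]] by simp
  qed (use H in simp)
  \<comment> \<open>\<open>H T\<close> is the history up to \<open>p t\<close>, and
    \<open>n < length (H n)\<close> ensures \<open>t \<ge> T\<close>.\<close>
  define t where "t = length (H T) - 1"
  have t: "Suc t = length (H T)" "t \<ge> T" using len[of T] by (auto simp: t_def)
  have "H T = map p [0..<t] @ [p t]" using p(2)[of T] t(1)[symmetric] by simp
  then have "s (H T) = team_position s p (Suc t)" "last (H T) = p t"
    by (auto simp: team_position_def fun_eq_iff)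
  then show False using T[OF t(2)] H(1)[of T] by simp
qed

text \<open>The relation collects the positions at the ends of secure histories. Security passes to
  extensions, which yields the replies, and connectedness lets one secure history be extended to end
  at any vertex.\<close>

lemma bodyguards_win_imp_guarding:
  assumes "bodyguards_win G k" "lazy_connected G"
  obtains S where "guarding G k S"
proof -
  obtain s where s: "team_strategy G k s"
    and win: "\<And>p. lazy_walk G p \<Longrightarrow> \<exists>T. \<forall>t\<ge>T. surrounded G k (team_position s p (Suc t)) (p t)"
    using assms(1) unfolding bodyguards_win_def by blast
  define secure where "secure h \<longleftrightarrow> lazy_path G h \<and> h \<noteq> [] \<and>
    (\<forall>e. lazy_path G (h @ e) \<longrightarrow> surrounded G k (s (h @ e)) (last (h @ e)))" for h
  obtain h0 where h0: "secure h0"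
    using bodyguards_win_imp_secure_history[OF s win] assms(2)
    unfolding secure_def lazy_connected_def by metis
  have ext: "secure (h @ [v])" if "secure h" "lazy_step G (last h) v" for h v
  proof -
    have "lazy_path G (h @ [v])"
      using that by (auto simp: secure_def lazy_path_snoc lazy_stepD2)
    moreover have "surrounded G k (s ((h @ [v]) @ e)) (last ((h @ [v]) @ e))"
      if "lazy_path G ((h @ [v]) @ e)" for e
      using that \<open>secure h\<close> unfolding secure_def append_assoc by blast
    ultimately show ?thesis by (simp add: secure_def)
  qed
  define S where "S = {(last h, s h) | h. secure h}"
  have "\<exists>h. secure h \<and> last h = u" if "(lazy_step G)\<^sup>*\<^sup>* (last h0) u" for u
    using that
  proof (induction rule: rtranclp_induct)
    case base
    then show ?case using h0 by blast
  next
    case (step y z)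
    then show ?case using ext by (metis last_snoc)
  qed
  moreover have "last h0 \<in> pverts G"
    using h0 by (auto simp: secure_def lazy_path_def)
  ultimately have "\<forall>u\<in>pverts G. \<exists>b. (u, b) \<in> S"
    using assms(2) unfolding lazy_connected_def S_def by blast
  moreover have "surrounded G k (s h) (last h)" "\<forall>i<k. s h i \<in> pverts G" if "secure h" for h
    using that team_strategy_in_verts[OF s] unfolding secure_def by (metis append_Nil2, blast)
  moreover have "\<exists>b'. (v, b') \<in> S \<and> (\<forall>i<k. lazy_step G (s h i) (b' i))"
    if "secure h" "lazy_step G (last h) v" for h v
  proof (intro exI conjI allI impI)
    have sec: "secure (h @ [v])" using ext that by blast
    then show "(v, s (h @ [v])) \<in> S" unfolding S_def by force
    show "lazy_step G (s h i) (s (h @ [v]) i)" if "i < k" for i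
      using team_strategy_lazy_step[OF s _ that] sec by (simp add: secure_def)
  qed
  ultimately have "guarding G k S"
    unfolding guarding_def S_def by blast
  then show ?thesis using that by blast
qed

section \<open>Cartesian products\<close>

lemma pverts_cartesian_product: "pverts (G \<box> H) = pverts G \<times> pverts H"
  by (simp add: cartesian_product_def)

lemma parcs_cartesian_product:
  "((u, v), (x, y)) \<in> parcs (G \<box> H) \<longleftrightarrow>
     u \<in> pverts G \<and> v \<in> pverts H \<and> x \<in> pverts G \<and> y \<in> pverts H \<and>
     ((u, x) \<in> parcs G \<and> v = y \<or> u = x \<and> (v, y) \<in> parcs H)"
  by (auto simp: cartesian_product_def)

lemma lazy_step_cartesian_product:
  "lazy_step (G \<box> H) (u, v) (x, y) \<longleftrightarrow>
     lazy_step G u x \<and> v = y \<and> v \<in> pverts H \<or> u = x \<and> u \<in> pverts G \<and> lazy_step H v y"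
  by (auto simp: lazy_step_def pverts_cartesian_product parcs_cartesian_product)

lemma pair_graph_cartesian_product:
  assumes "pair_graph G" "pair_graph H"
  shows "pair_graph (G \<box> H)"
proof -
  interpret G: pair_graph G by fact
  interpret H: pair_graph H by fact
  have verts: "finite (pverts (G \<box> H))"
    by (simp add: pverts_cartesian_product G.pair_finite_verts H.pair_finite_verts)
  have arcs: "parcs (G \<box> H) \<subseteq> pverts (G \<box> H) \<times> pverts (G \<box> H)"
    by (auto simp: cartesian_product_def)
  have "sym (parcs G)" "sym (parcs H)"
    using G.pair_sym_arcs H.pair_sym_arcs by (simp_all add: symmetric_def)
  then have "sym (parcs (G \<box> H))"
    unfolding sym_def by (auto simp: parcs_cartesian_product)
  moreover have "finite (parcs (G \<box> H))"
    using verts arcs finite_subset by blast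
  moreover have "fst e \<noteq> snd e" if "e \<in> parcs (G \<box> H)" for e
    using that G.pair_no_loops H.pair_no_loops by (force simp: cartesian_product_def)
  ultimately show ?thesis
    using verts arcs by unfold_locales (auto simp: symmetric_def)
qed

lemma lazy_connected_cartesian_product:
  assumes "lazy_connected G" "lazy_connected H"
  shows "lazy_connected (G \<box> H)"
proof -
  have left: "(lazy_step (G \<box> H))\<^sup>*\<^sup>* (u, v) (x, v)"
    if "(lazy_step G)\<^sup>*\<^sup>* u x" "v \<in> pverts H" for u v x
    using that(1)
  proof (induction rule: rtranclp_induct)
    case (step y z)
    then have "lazy_step (G \<box> H) (y, v) (z, v)"
      using that(2) by (simp add: lazy_step_cartesian_product)
    with step show ?case by simp
  qed simp
  have right: "(lazy_step (G \<box> H))\<^sup>*\<^sup>* (u, v) (u, x)"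
    if "(lazy_step H)\<^sup>*\<^sup>* v x" "u \<in> pverts G" for u v x
    using that(1)
  proof (induction rule: rtranclp_induct)
    case (step y z)
    then have "lazy_step (G \<box> H) (u, y) (u, z)"
      using that(2) by (simp add: lazy_step_cartesian_product)
    with step show ?case by simp
  qed simp
  have "(lazy_step (G \<box> H))\<^sup>*\<^sup>* (u, v) (x, y)"
    if "u \<in> pverts G" "v \<in> pverts H" "x \<in> pverts G" "y \<in> pverts H" for u v x y
    using left[of u x v] right[of v y x] that assms
    unfolding lazy_connected_def by (meson rtranclp_trans)
  with assms show ?thesis
    unfolding lazy_connected_def by (auto simp: pverts_cartesian_product)
qed

text \<open>
  The guards for \<open>G\<close> live in the copy of \<open>G\<close> through the president and are carried along when the
  president moves in \<open>H\<close>; the guards for \<open>H\<close> symmetrically.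
\<close>

lemma guarding_cartesian_product:
  assumes G: "guarding G k S" and H: "guarding H l T"
  obtains U where "guarding (G \<box> H) (k + l) U"
proof -
  \<comment> \<open>Guards of \<open>G\<close> have the indices below \<open>k\<close>; guard
    \<open>i\<close> of \<open>H\<close> has index \<open>k + i\<close>.\<close>
  define comb where "comb u v b c = (\<lambda>i. if i < k then (b i, v) else (u, c (i - k)))"
    for u :: 'a and v :: 'b and b c
  define U where "U = {((u, v), comb u v b c) | u v b c.
    u \<in> pverts G \<and> v \<in> pverts H \<and> (u, b) \<in> S \<and> (v, c) \<in> T}"
  have total: "\<forall>w\<in>pverts (G \<box> H). \<exists>d. (w, d) \<in> U"
    using G H unfolding guarding_def U_def pverts_cartesian_product by blast
  have step: "surrounded (G \<box> H) (k + l) (comb u v b c) (u, v) \<and>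
      (\<forall>i<k + l. comb u v b c i \<in> pverts (G \<box> H)) \<and>
      (\<forall>w. lazy_step (G \<box> H) (u, v) w \<longrightarrow>
        (\<exists>d. (w, d) \<in> U \<and> (\<forall>i<k + l. lazy_step (G \<box> H) (comb u v b c i) (d i))))"
    if uv: "u \<in> pverts G" "v \<in> pverts H" and bc: "(u, b) \<in> S" "(v, c) \<in> T" for u v b c
  proof (intro conjI allI impI)
    have b: "surrounded G k b u" "\<And>i. i < k \<Longrightarrow> b i \<in> pverts G"
      and c: "surrounded H l c v" "\<And>i. i < l \<Longrightarrow> c i \<in> pverts H"
      using G H bc unfolding guarding_def by blast+
    show "surrounded (G \<box> H) (k + l) (comb u v b c) (u, v)"
      unfolding surrounded_def
    proof (intro allI impI)
      fix w assume w: "((u, v), w) \<in> parcs (G \<box> H)"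
      obtain x y where xy: "w = (x, y)" by (cases w)
      consider "(u, x) \<in> parcs G" "v = y" | "u = x" "(v, y) \<in> parcs H"
        using w unfolding xy parcs_cartesian_product by blast
      then show "\<exists>i<k + l. comb u v b c i = w"
      proof cases
        case 1
        then obtain i where "i < k" "b i = x" using b(1) unfolding surrounded_def by blast
        with 1 xy show ?thesis by (intro exI[of _ i]) (simp add: comb_def)
      next
        case 2
        then obtain i where "i < l" "c i = y" using c(1) unfolding surrounded_def by blast
        with 2 xy show ?thesis by (intro exI[of _ "k + i"]) (simp add: comb_def)
      qed
    qed
    show "comb u v b c i \<in> pverts (G \<box> H)" if "i < k + l" for i
      using that b(2) c(2) uv by (simp add: comb_def pverts_cartesian_product)
    fix w assume w: "lazy_step (G \<box> H) (u, v) w"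
    obtain x y where xy: "w = (x, y)" by (cases w)
    consider "lazy_step G u x" "v = y" | "u = x" "lazy_step H v y"
      using w unfolding xy lazy_step_cartesian_product by blast
    then show "\<exists>d. (w, d) \<in> U \<and> (\<forall>i<k + l. lazy_step (G \<box> H) (comb u v b c i) (d i))"
    proof cases
      case 1
      then obtain b' where "(x, b') \<in> S" "\<forall>i<k. lazy_step G (b i) (b' i)"
        using G bc unfolding guarding_def by blast
      with 1 xy uv bc c(2) show ?thesis
        by (intro exI[of _ "comb x v b' c"])
           (auto simp: U_def comb_def lazy_step_cartesian_product intro: lazy_stepD2)
    next
      case 2
      then obtain c' where "(y, c') \<in> T" "\<forall>i<l. lazy_step H (c i) (c' i)"
        using H bc unfolding guarding_def by blast
      with 2 xy uv bc b(2) show ?thesis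
        by (intro exI[of _ "comb u y b c'"])
           (auto simp: U_def comb_def lazy_step_cartesian_product intro: lazy_stepD2)
    qed
  qed
  have "guarding (G \<box> H) (k + l) U"
    unfolding guarding_def
  proof (intro conjI total allI impI)
    fix w d assume "(w, d) \<in> U"
    then obtain u v b c where "w = (u, v)" "d = comb u v b c"
        "u \<in> pverts G" "v \<in> pverts H" "(u, b) \<in> S" "(v, c) \<in> T"
      unfolding U_def by blast
    note * = step[OF this(3-6), folded this(1,2)]
    show "surrounded (G \<box> H) (k + l) d w" "\<And>i. i < k + l \<Longrightarrow> d i \<in> pverts (G \<box> H)"
      "\<And>x. lazy_step (G \<box> H) w x \<Longrightarrow>
         \<exists>d'. (x, d') \<in> U \<and> (\<forall>i<k + l. lazy_step (G \<box> H) (d i) (d' i))"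
      using * by blast+
  qed
  then show ?thesis using that by blast
qed

section \<open>Forcing a target set of game states\<close>

text \<open>
  \<open>E x v\<close>: in state \<open>x\<close> the opponent may play \<open>v\<close>; \<open>R x v y\<close>: then \<open>y\<close> is an allowed reply.
\<close>

inductive forces :: "('x \<Rightarrow> 'a \<Rightarrow> bool) \<Rightarrow> ('x \<Rightarrow> 'a \<Rightarrow> 'x \<Rightarrow> bool) \<Rightarrow> 'x set \<Rightarrow> 'x \<Rightarrow> bool"
  for E R W where
  target: "x \<in> W \<Longrightarrow> forces E R W x"
| reply: "(\<And>v. E x v \<Longrightarrow> \<exists>y. R x v y \<and> forces E R W y) \<Longrightarrow> forces E R W x"

text \<open>Chains the phases of the hunt: each starts in the set that the previous one
  forces.\<close>

lemma forces_trans: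
  assumes "forces E R W x" "\<And>y. y \<in> W \<Longrightarrow> forces E R V y"
  shows "forces E R V x"
  using assms(1)
proof induction
  case (target x)
  then show ?case using assms(2) by blast
next
  case (reply x)
  then show ?case by (metis forces.reply)
qed

text \<open>As in the bodyguard game, \<open>W\<close> has to be kept from some time on, not just
  reached. The reply rule covers all lists \<open>h\<close>, even those with illegal moves; the
  winning clause covers only legal plays.\<close>

definition winning_from ::
  "('x \<Rightarrow> 'a \<Rightarrow> bool) \<Rightarrow> ('x \<Rightarrow> 'a \<Rightarrow> 'x \<Rightarrow> bool) \<Rightarrow> 'x set \<Rightarrow> 'x \<Rightarrow> ('a list \<Rightarrow> 'x) \<Rightarrow> bool" where
  "winning_from E R W x \<sigma> \<longleftrightarrow>
     \<sigma> [] = x \<and> (\<forall>h v. E (\<sigma> h) v \<longrightarrow> R (\<sigma> h) v (\<sigma> (h @ [v]))) \<and>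
     (\<forall>p. (\<forall>n. E (\<sigma> (map p [0..<n])) (p n)) \<longrightarrow> (\<exists>T. \<forall>t\<ge>T. \<sigma> (map p [0..<t]) \<in> W))"

lemma winning_from_target:
  assumes "x \<in> W" and closed: "\<And>x v. x \<in> W \<Longrightarrow> E x v \<Longrightarrow> \<exists>y\<in>W. R x v y"
  shows "\<exists>\<sigma>. winning_from E R W x \<sigma>"
proof -
  obtain r where r: "\<And>x v. x \<in> W \<Longrightarrow> E x v \<Longrightarrow> r x v \<in> W \<and> R x v (r x v)"
    using closed by metis
  \<comment> \<open>Illegal moves leave the state unchanged, so \<open>W\<close> is an invariant on
    every list.\<close>
  define \<sigma> where "\<sigma> = foldl (\<lambda>x v. if E x v then r x v else x) x"
  have "\<sigma> h \<in> W" for h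
    by (induction h rule: rev_induct) (use assms(1) r in \<open>auto simp: \<sigma>_def\<close>)
  with r have "winning_from E R W x \<sigma>"
    by (auto simp: winning_from_def \<sigma>_def)
  then show ?thesis by blast
qed

text \<open>Strategies for the different opening moves are glued: the opening move \<open>v\<close>
  selects \<open>\<tau> v\<close>, which then sees only the rest of the history.\<close>

lemma winning_from_reply:
  assumes "\<And>v. E x v \<Longrightarrow> \<exists>y \<sigma>. R x v y \<and> winning_from E R W y \<sigma>"
  shows "\<exists>\<sigma>. winning_from E R W x \<sigma>"
proof -
  obtain \<tau> where \<tau>: "\<And>v. E x v \<Longrightarrow> R x v (\<tau> v []) \<and> winning_from E R W (\<tau> v []) (\<tau> v)"
    using assms unfolding winning_from_def by metis
  \<comment> \<open>Illegal opening moves are skipped, so that every list is a history.\<close>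
  define \<sigma> where "\<sigma> h = (case dropWhile (\<lambda>v. \<not> E x v) h of [] \<Rightarrow> x | v # h' \<Rightarrow> \<tau> v h')" for h
  have "R (\<sigma> h) v (\<sigma> (h @ [v]))" if "E (\<sigma> h) v" for h v
  proof (cases "dropWhile (\<lambda>v. \<not> E x v) h")
    case Nil
    then have "\<sigma> h = x" unfolding \<sigma>_def by (simp only: list.case)
    with that have "E x v" by simp
    then have "\<sigma> (h @ [v]) = \<tau> v []"
      using Nil by (simp add: \<sigma>_def dropWhile_append)
    with \<open>\<sigma> h = x\<close> show ?thesis using \<tau> that by simp
  next
    case (Cons w h')
    then have "E x w"
      using hd_dropWhile[of "\<lambda>v. \<not> E x v" h] by simp
    have "dropWhile (\<lambda>v. \<not> E x v) (h @ [v]) = w # h' @ [v]"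
      using Cons \<open>E x w\<close> set_dropWhileD[of w "\<lambda>v. \<not> E x v" h]
      by (auto simp: dropWhile_append)
    with Cons \<tau>[OF \<open>E x w\<close>] that show ?thesis by (simp add: \<sigma>_def winning_from_def)
  qed
  moreover have "\<exists>T. \<forall>t\<ge>T. \<sigma> (map p [0..<t]) \<in> W"
    if p: "\<And>n. E (\<sigma> (map p [0..<n])) (p n)" for p
  proof -
    have "E x (p 0)" using p[of 0] by (simp add: \<sigma>_def)
    \<comment> \<open>The play seen by the selected strategy lags by one move, so its threshold
      \<open>T\<close> becomes \<open>Suc T\<close>.\<close>
    have shift: "\<sigma> (map p [0..<Suc n]) = \<tau> (p 0) (map (\<lambda>n. p (Suc n)) [0..<n])" for n
    proof -
      have "map p [0..<Suc n] = p 0 # map (\<lambda>n. p (Suc n)) [0..<n]"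
        by (simp add: map_upt_Suc del: upt_Suc)
      with \<open>E x (p 0)\<close> show ?thesis by (simp add: \<sigma>_def del: upt_Suc)
    qed
    have "\<exists>T. \<forall>t\<ge>T. \<tau> (p 0) (map (\<lambda>n. p (Suc n)) [0..<t]) \<in> W"
      using \<tau>[OF \<open>E x (p 0)\<close>] p shift unfolding winning_from_def by metis
    then obtain T where T: "\<And>t. t \<ge> T \<Longrightarrow> \<sigma> (map p [0..<Suc t]) \<in> W"
      unfolding shift by blast
    show ?thesis
    proof (intro exI[of _ "Suc T"] allI impI)
      fix t assume "Suc T \<le> t"
      then show "\<sigma> (map p [0..<t]) \<in> W" using T[of "t - 1"] by (cases t) auto
    qed
  qed
  ultimately have "winning_from E R W x \<sigma>"
    by (auto simp: winning_from_def \<sigma>_def)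
  then show ?thesis by blast
qed

text \<open>Induction on \<open>forces\<close> turns forcing into one strategy on histories. Closure
  of \<open>W\<close> under replies turns reaching it into staying there.\<close>

lemma forces_imp_winning_from:
  assumes "forces E R W x" and "\<And>x v. x \<in> W \<Longrightarrow> E x v \<Longrightarrow> \<exists>y\<in>W. R x v y"
  shows "\<exists>\<sigma>. winning_from E R W x \<sigma>"
  using assms(1)
proof induction
  case (target x)
  then show ?case using winning_from_target assms(2) by metis
next
  case (reply x)
  then show ?case using winning_from_reply by metis
qed

section \<open>Catching the virtual guards\<close>

text \<open>
  A state consists of the president's position, the positions of \<open>k\<close> virtual guards moving according
  to the guarding relation \<open>S\<close>, and the positions of the \<open>N\<close> real tokens.
\<close>

locale escort =
  fixes G :: "'a pair_pre_digraph" and k :: nat and S :: "('a \<times> (nat \<Rightarrow> 'a)) set" and N :: nat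
  assumes guarding: "guarding G k S"
begin

definition president_move :: "'a \<times> (nat \<Rightarrow> 'a) \<times> (nat \<Rightarrow> 'a) \<Rightarrow> 'a \<Rightarrow> bool" where
  "president_move = (\<lambda>(u, b, a) v. lazy_step G u v)"

text \<open>The virtual positions are mere bookkeeping and thus unrestricted here;
  \<open>tracked\<close> ties them to \<open>S\<close>.\<close>

definition token_reply ::
  "'a \<times> (nat \<Rightarrow> 'a) \<times> (nat \<Rightarrow> 'a) \<Rightarrow> 'a \<Rightarrow> 'a \<times> (nat \<Rightarrow> 'a) \<times> (nat \<Rightarrow> 'a) \<Rightarrow> bool" where
  "token_reply = (\<lambda>(u, b, a) v (u', b', a'). u' = v \<and> (\<forall>i<N. lazy_step G (a i) (a' i)))"

text \<open>Token \<open>f i\<close> follows virtual guard \<open>i\<close>. Injectivity leaves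
  exactly \<open>N - j\<close> tokens free.\<close>

definition tracked :: "nat \<Rightarrow> (nat \<Rightarrow> nat) \<Rightarrow> ('a \<times> (nat \<Rightarrow> 'a) \<times> (nat \<Rightarrow> 'a)) set" where
  "tracked j f = {(u, b, a). (u, b) \<in> S \<and> (\<forall>i<N. a i \<in> pverts G) \<and>
     inj_on f {..<j} \<and> f ` {..<j} \<subseteq> {..<N} \<and> (\<forall>i<j. a (f i) = b i)}"

abbreviation "forced W \<equiv> forces president_move token_reply W"

abbreviation "caught j \<equiv> (\<Union>f. tracked j f)"

text \<open>Followers copy their virtual guards, the free tokens \<open>g m\<close> obey the orders
  \<open>d\<close>, and all others wait. Since \<open>b'\<close> is fixed before \<open>d\<close>,
  the orders may depend on where the virtual guards go.\<close>

lemma tracked_reply: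
  assumes x: "(u, b, a) \<in> tracked j f" and "j \<le> k" and v: "lazy_step G u v"
    and g: "inj_on g {..<c}" "g ` {..<c} \<subseteq> {..<N} - f ` {..<j}"
  obtains b' where "\<And>i. i < k \<Longrightarrow> lazy_step G (b i) (b' i)"
    "\<And>d. (\<And>m. m < c \<Longrightarrow> lazy_step G (a (g m)) (d m)) \<Longrightarrow>
       \<exists>a'. token_reply (u, b, a) v (v, b', a') \<and> (v, b', a') \<in> tracked j f \<and>
            (\<forall>m<c. a' (g m) = d m)"
proof -
  have S: "(u, b) \<in> S" and a: "\<And>i. i < N \<Longrightarrow> a i \<in> pverts G"
    and f: "inj_on f {..<j}" "f ` {..<j} \<subseteq> {..<N}" "\<And>i. i < j \<Longrightarrow> a (f i) = b i"
    using x by (auto simp: tracked_def)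
  obtain b' where b': "(v, b') \<in> S" "\<And>i. i < k \<Longrightarrow> lazy_step G (b i) (b' i)"
    using guarding S v unfolding guarding_def by blast
  have "\<exists>a'. token_reply (u, b, a) v (v, b', a') \<and> (v, b', a') \<in> tracked j f \<and>
      (\<forall>m<c. a' (g m) = d m)"
    if d: "\<And>m. m < c \<Longrightarrow> lazy_step G (a (g m)) (d m)" for d
  proof -
    define a' where "a' n =
      (if n \<in> f ` {..<j} then b' (inv_into {..<j} f n)
       else if n \<in> g ` {..<c} then d (inv_into {..<c} g n) else a n)" for n
    have a'f: "a' (f i) = b' i" if "i < j" for i
      using that f(1) by (simp add: a'_def)
    have a'g: "a' (g m) = d m" if "m < c" for m
      using that g by (auto simp: a'_def)
    have step: "lazy_step G (a n) (a' n)" if "n < N" for n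
    proof -
      consider i where "n = f i" "i < j" | m where "n = g m" "m < c" | "a' n = a n"
        unfolding a'_def by (metis imageE lessThan_iff)
      then show ?thesis
      proof cases
        case 1
        then show ?thesis using a'f f(3) b'(2) \<open>j \<le> k\<close> by simp
      next
        case 2
        then show ?thesis using a'g d by simp
      next
        case 3
        then show ?thesis using a that by (simp add: lazy_step_refl)
      qed
    qed
    show ?thesis
      by (intro exI[of _ a'])
         (use step a'f a'g f b'(1) in \<open>auto simp: token_reply_def tracked_def dest: lazy_stepD2\<close>)
  qed
  with b'(2) that show ?thesis by blast
qed

lemma tracked_closed:
  assumes "x \<in> tracked j f" "j \<le> k" "president_move x v"
  shows "\<exists>y\<in>tracked j f. token_reply x v y"
proof -
  obtain u b a where x: "x = (u, b, a)" by (cases x)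
  have v: "lazy_step G u v" using assms(3) by (simp add: x president_move_def)
  \<comment> \<open>With \<open>c = 0\<close> no orders are given and only the followers
    react.\<close>
  show ?thesis
    unfolding x
    by (rule tracked_reply[OF assms(1)[unfolded x] assms(2) v, of id 0]) (simp, simp, blast)
qed

text \<open>Each round orders the free tokens one step along their walks, whatever the president
  does; the common length \<open>n\<close> makes them arrive together.\<close>

lemma forced_reposition:
  assumes "(u, b, a) \<in> tracked j f" "j \<le> k"
    and g: "inj_on g {..<c}" "g ` {..<c} \<subseteq> {..<N} - f ` {..<j}"
    and "\<And>m. m < c \<Longrightarrow> (lazy_step G ^^ n) (a (g m)) (d m)"
  shows "forced (tracked j f \<inter> {(u, b, a). \<forall>m<c. a (g m) = d m}) (u, b, a)"
  using assms(1,5)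
proof (induction n arbitrary: u b a)
  case 0
  then show ?case by (intro target) auto
next
  case (Suc n)
  have "\<exists>w. lazy_step G (a (g m)) w \<and> (lazy_step G ^^ n) w (d m)" if "m < c" for m
    using relpowp_Suc_D2[OF Suc.prems(2)[OF that]] .
  then obtain e where e: "\<And>m. m < c \<Longrightarrow> lazy_step G (a (g m)) (e m)"
      "\<And>m. m < c \<Longrightarrow> (lazy_step G ^^ n) (e m) (d m)"
    by metis
  show ?case
  proof (rule reply)
    fix v assume "president_move (u, b, a) v"
    then have "lazy_step G u v" by (simp add: president_move_def)
    then obtain b' a' where
      "token_reply (u, b, a) v (v, b', a')" "(v, b', a') \<in> tracked j f" "\<forall>m<c. a' (g m) = e m"
      using tracked_reply[OF Suc.prems(1) assms(2) _ g] e(1) by metis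
    then show "\<exists>y. token_reply (u, b, a) v y \<and>
        forced (tracked j f \<inter> {(u, b, a). \<forall>m<c. a (g m) = d m}) y"
      using e(2) by (intro exI[of _ "(v, b', a')"] conjI Suc.IH) simp_all
  qed
qed

lemma tracked_catch:
  assumes "(u, b, a) \<in> tracked j f" "n < N" "n \<notin> f ` {..<j}" "a n = b j"
  shows "(u, b, a) \<in> tracked (Suc j) (f(j := n))"
  using assms by (auto simp: tracked_def lessThan_Suc less_Suc_eq inj_on_def)

text \<open>
  Virtual guard \<open>j\<close> plays the robber against the tokens \<open>g m\<close>. If catching it could not be forced, the
  president could evade forever, and the trajectory of guard \<open>j\<close> would escape the cops.
\<close>

lemma forced_chase:
  assumes s: "team_strategy G c s"
    and win: "\<And>p. lazy_walk G p \<Longrightarrow>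
      \<exists>t. \<exists>i<c. team_position s p t i = p t \<or> team_position s p (Suc t) i = p t"
    and x0: "(u0, b0, a0) \<in> tracked j f" and "j < k"
    and g: "inj_on g {..<c}" "g ` {..<c} \<subseteq> {..<N} - f ` {..<j}"
    and start: "\<And>m. m < c \<Longrightarrow> a0 (g m) = s [] m"
  shows "forced (caught (Suc j)) (u0, b0, a0)"
proof (rule ccontr)
  assume contra: "\<not> ?thesis"
  \<comment> \<open>\<open>h\<close> records guard \<open>j\<close> only from its first reply on:
    the tokens already stand at \<open>s []\<close>, so the robber is placed after the cops.\<close>
  define P where "P n = (\<lambda>((u, b, a), h). (u, b, a) \<in> tracked j f \<and> (\<forall>m<c. a (g m) = s h m) \<and>
    lazy_path G h \<and> (h \<noteq> [] \<longrightarrow> last h = b j) \<and> length h = n \<and>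
    \<not> forced (caught (Suc j)) (u, b, a))" for n :: nat
  define Q where "Q = (\<lambda>(x :: 'a \<times> (nat \<Rightarrow> 'a) \<times> (nat \<Rightarrow> 'a), h) (y :: 'a \<times> (nat \<Rightarrow> 'a) \<times> (nat \<Rightarrow> 'a), h').
    \<exists>w. h' = h @ [w] \<and> (\<forall>m<c. s h m \<noteq> w \<and> s h' m \<noteq> w))"
  have init: "P 0 ((u0, b0, a0), [])"
    using x0 start contra by (simp add: P_def lazy_path_Nil)
  have step: "\<exists>y. P (Suc n) y \<and> Q x y" if "P n x" for n x
  proof -
    obtain u b a h where x: "x = ((u, b, a), h)" by (metis surj_pair)
    have tr: "(u, b, a) \<in> tracked j f" and ag: "\<And>m. m < c \<Longrightarrow> a (g m) = s h m"
      and path: "lazy_path G h" and last: "h \<noteq> [] \<Longrightarrow> last h = b j" and len: "length h = n"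
      and nf: "\<not> forced (caught (Suc j)) (u, b, a)"
      using that by (auto simp: P_def x)
    obtain v where v: "president_move (u, b, a) v"
      and evade: "\<And>y. token_reply (u, b, a) v y \<Longrightarrow> \<not> forced (caught (Suc j)) y"
      using nf reply[of president_move "(u, b, a)" token_reply "caught (Suc j)"] by blast
    have "lazy_step G u v" using v by (simp add: president_move_def)
    then obtain b' where b': "\<And>i. i < k \<Longrightarrow> lazy_step G (b i) (b' i)"
      and resp: "\<And>d. (\<And>m. m < c \<Longrightarrow> lazy_step G (a (g m)) (d m)) \<Longrightarrow>
        \<exists>a'. token_reply (u, b, a) v (v, b', a') \<and> (v, b', a') \<in> tracked j f \<and>
            (\<forall>m<c. a' (g m) = d m)"
      using tracked_reply[OF tr _ _ g] \<open>j < k\<close> by (metis less_imp_le)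
    have free: "g m < N" "g m \<notin> f ` {..<j}" if "m < c" for m
      using g(2) that by auto
    have path': "lazy_path G (h @ [b' j])"
      using path last b'[OF \<open>j < k\<close>] by (auto simp: lazy_path_snoc lazy_stepD2)
    \<comment> \<open>Orders that put a token on \<open>b' j\<close> would catch guard
      \<open>j\<close>, against the choice of \<open>v\<close>. The real tokens know
      \<open>b' j\<close> when they move, so a robber move and the answer of the cops fit into one
      turn.\<close>
    have apart: "d m \<noteq> b' j" if d: "\<And>m. m < c \<Longrightarrow> lazy_step G (a (g m)) (d m)" and "m < c" for d m
    proof
      assume eq: "d m = b' j"
      obtain a' where a': "token_reply (u, b, a) v (v, b', a')" "(v, b', a') \<in> tracked j f"
          "\<forall>m<c. a' (g m) = d m"
        using resp[OF d] by blast
      then have "(v, b', a') \<in> tracked (Suc j) (f(j := g m))"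
        using eq \<open>m < c\<close> free tracked_catch by metis
      then show False using evade[OF a'(1)] by (blast intro: target)
    qed
    \<comment> \<open>Waiting at \<open>s h m\<close> covers the case that the robber walks into a
      cop.\<close>
    have stay: "lazy_step G (a (g m)) (s h m)" if "m < c" for m
      using ag[OF that] team_strategy_in_verts[OF s path that] by (simp add: lazy_step_refl)
    have move: "lazy_step G (a (g m)) (s (h @ [b' j]) m)" if "m < c" for m
      using ag[OF that] team_strategy_lazy_step[OF s path' that] by simp
    obtain a' where a': "token_reply (u, b, a) v (v, b', a')" "(v, b', a') \<in> tracked j f"
        "\<forall>m<c. a' (g m) = s (h @ [b' j]) m"
      using resp[OF move] by blast
    have "P (Suc n) ((v, b', a'), h @ [b' j])"
      using a' path' len evade[OF a'(1)] by (simp add: P_def)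
    moreover have "Q x ((v, b', a'), h @ [b' j])"
      using apart[OF stay] apart[OF move] by (simp add: Q_def x)
    ultimately show ?thesis by blast
  qed
  obtain X where X: "\<And>n. P n (X n)" "\<And>n. Q (X n) (X (Suc n))"
    using dependent_nat_choice[of P "\<lambda>_. Q"] init step by metis
  define H where "H n = snd (X n)" for n
  have H: "lazy_path G (H n)" "length (H n) = n" for n
    using X(1)[of n] by (auto simp: P_def H_def split: prod.splits)
  have Hs: "\<exists>w. H (Suc n) = H n @ [w] \<and> (\<forall>m<c. s (H n) m \<noteq> w \<and> s (H (Suc n)) m \<noteq> w)" for n
    using X(2)[of n] by (simp add: Q_def H_def split: prod.splits)
  have "strict_prefix (H n) (H (Suc n))" for n
    using Hs[of n] by (auto simp: strict_prefix_def)
  then obtain p where p: "lazy_walk G p" "\<And>n. map p [0..<length (H n)] = H n"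
    using lazy_path_prefixes_imp_lazy_walk[of G H] H(1) by metis
  have tp: "team_position s p n = s (H n)" for n
    using p(2)[of n] by (simp add: team_position_def fun_eq_iff H(2))
  have "s (H t) i \<noteq> p t \<and> s (H (Suc t)) i \<noteq> p t" if "i < c" for t i
  proof -
    have "H (Suc t) = H t @ [p t]"
      using p(2)[of t] p(2)[of "Suc t"] by (simp add: H(2))
    with Hs[of t] that show ?thesis by auto
  qed
  then show False using win[OF p(1)] unfolding tp by blast
qed

text \<open>The \<open>j\<close> followers leave at least \<open>c\<close> tokens free. These first
  gather at the initial placement of the cops and then chase guard \<open>j\<close>.\<close>

lemma forced_catch_next:
  assumes "cops_win G c" "lazy_connected G" "x \<in> caught j" "j < k" "j + c \<le> N"
  shows "forced (caught (Suc j)) x"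
proof -
  obtain s where s: "team_strategy G c s"
    and win: "\<And>p. lazy_walk G p \<Longrightarrow>
      \<exists>t. \<exists>i<c. team_position s p t i = p t \<or> team_position s p (Suc t) i = p t"
    using assms(1) unfolding cops_win_def by blast
  obtain u b a f where x: "x = (u, b, a)" and tr: "(u, b, a) \<in> tracked j f"
    using assms(3) by (cases x) auto
  have f: "inj_on f {..<j}" "f ` {..<j} \<subseteq> {..<N}" and a: "\<And>i. i < N \<Longrightarrow> a i \<in> pverts G"
    using tr by (auto simp: tracked_def)
  have "card ({..<N} - f ` {..<j}) = N - j"
    using f by (simp add: card_Diff_subset card_image)
  then have "card {..<c} \<le> card ({..<N} - f ` {..<j})" using assms(5) by simp
  then obtain g where g: "inj_on g {..<c}" "g ` {..<c} \<subseteq> {..<N} - f ` {..<j}"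
    using card_le_inj[of "{..<c}" "{..<N} - f ` {..<j}"] by auto
  have s0: "s [] m \<in> pverts G" if "m < c" for m
    using s that by (simp add: team_strategy_def)
  have "\<exists>n. (lazy_step G ^^ n) (a (g m)) (s [] m)" if "m < c" for m
  proof -
    have "g m < N" using g(2) that by auto
    then show ?thesis
      using assms(2) a s0[OF that] unfolding lazy_connected_def by (metis rtranclp_imp_relpowp)
  qed
  then obtain n where n: "\<And>m. m < c \<Longrightarrow> (lazy_step G ^^ n m) (a (g m)) (s [] m)"
    by metis
  \<comment> \<open>The sum serves as a common upper bound for the lengths
    \<open>n m\<close>.\<close>
  have "(lazy_step G ^^ (\<Sum>m<c. n m)) (a (g m)) (s [] m)" if "m < c" for m
    using relpowp_lazy_step_mono[OF n[OF that] _ s0[OF that]] that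
    by (simp add: member_le_sum)
  then have "forced (tracked j f \<inter> {(u, b, a). \<forall>m<c. a (g m) = s [] m}) x"
    unfolding x using assms(4) by (intro forced_reposition[OF tr _ g]) simp_all
  then show ?thesis
  proof (rule forces_trans)
    fix y assume "y \<in> tracked j f \<inter> {(u, b, a). \<forall>m<c. a (g m) = s [] m}"
    then show "forced (caught (Suc j)) y"
      using forced_chase[OF s win _ assms(4) g] by (cases y) auto
  qed
qed

text \<open>The saved bodyguard: a hunt happens only for \<open>j < k\<close>, so at most
  \<open>k - 1\<close> tokens are following and \<open>k + c \<le> Suc N\<close> leaves
  \<open>c\<close> free.\<close>

lemma forced_catch_all:
  assumes "cops_win G c" "lazy_connected G" "k + c \<le> Suc N" "x \<in> caught 0"
  shows "forced (caught k) x"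
proof -
  have "forced (caught j) x" if "j \<le> k" for j
    using that
  proof (induction j)
    case 0
    show ?case using assms(4) by (rule target)
  next
    case (Suc j)
    then have "forced (caught j) x" by simp
    then show ?case
      using forced_catch_next[OF assms(1,2)] Suc.prems assms(3)
      by (elim forces_trans) simp
  qed
  then show ?thesis by simp
qed

lemma caught_surrounded:
  assumes "(u, b, a) \<in> caught k"
  shows "surrounded G N a u"
proof -
  obtain f where "(u, b) \<in> S" "f ` {..<k} \<subseteq> {..<N}" "\<And>i. i < k \<Longrightarrow> a (f i) = b i"
    using assms by (auto simp: tracked_def)
  moreover have "surrounded G k b u"
    using guarding calculation(1) unfolding guarding_def by blast
  ultimately show ?thesis
    unfolding surrounded_def by (metis image_subset_iff lessThan_iff)
qed

text \<open>All tokens start at one vertex \<open>u0\<close>; the virtual guards are imagined once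
  the president is placed, and the state game begins there.\<close>

lemma bodyguards_win:
  assumes "cops_win G c" "lazy_connected G" "k + c \<le> Suc N"
  shows "bodyguards_win G N"
proof -
  obtain u0 where u0: "u0 \<in> pverts G" using assms(2) by (auto simp: lazy_connected_def)
  obtain b where b: "\<And>u. u \<in> pverts G \<Longrightarrow> (u, b u) \<in> S"
    using guarding unfolding guarding_def by metis
  let ?x = "\<lambda>u. (u, b u, \<lambda>_::nat. u0)"
  have "?x u \<in> tracked 0 id" if "u \<in> pverts G" for u
    using b that u0 by (simp add: tracked_def)
  then have "forced (caught k) (?x u)" if "u \<in> pverts G" for u
    using forced_catch_all[OF assms] that by blast
  then have "\<exists>\<sigma>. winning_from president_move token_reply (caught k) (?x u) \<sigma>"
    if "u \<in> pverts G" for u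
  proof (rule forces_imp_winning_from)
    fix x v assume "x \<in> caught k" "president_move x v"
    then show "\<exists>y\<in>caught k. token_reply x v y" using tracked_closed by blast
  qed (use that in simp)
  then obtain \<sigma> where \<sigma>: "\<And>u. u \<in> pverts G \<Longrightarrow>
      winning_from president_move token_reply (caught k) (?x u) (\<sigma> u)"
    by metis
  \<comment> \<open>\<open>\<sigma> u []\<close> is still the initial state, so the first turn is
    spent waiting. From then on \<open>st p n\<close> is the state after turn
    \<open>n + 1\<close>.\<close>
  define s where "s h = (case h of [] \<Rightarrow> (\<lambda>_. u0) | u # h' \<Rightarrow> snd (snd (\<sigma> u h')))" for h
  define st where "st p n = \<sigma> (p 0) (map (\<lambda>n. p (Suc n)) [0..<n])" for p n
  have pos: "team_position s p (Suc n) = snd (snd (st p n))" for p n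
  proof -
    have "map p [0..<Suc n] = p 0 # map (\<lambda>n. p (Suc n)) [0..<n]"
      by (simp add: map_upt_Suc del: upt_Suc)
    then show ?thesis by (simp add: team_position_def s_def st_def fun_eq_iff del: upt_Suc)
  qed
  have st0: "st p 0 = ?x (p 0)" if "lazy_walk G p" for p
    using \<sigma>[of "p 0"] that by (simp add: st_def winning_from_def lazy_walk_def)
  have st_reply: "token_reply (st p n) (p (Suc n)) (st p (Suc n))"
    if "lazy_walk G p" "president_move (st p n) (p (Suc n))" for p n
    using \<sigma>[of "p 0"] that by (simp add: st_def winning_from_def lazy_walk_def)
  \<comment> \<open>Legality of a president move is judged by the position stored in the state,
    which therefore must be shown to agree with \<open>p\<close>.\<close>
  have fst_st: "fst (st p n) = p n" if p: "lazy_walk G p" for p n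
  proof (induction n)
    case 0
    then show ?case using st0[OF p] by simp
  next
    case (Suc n)
    then have "president_move (st p n) (p (Suc n))"
      using p by (auto simp: president_move_def lazy_walk_def split: prod.splits)
    from st_reply[OF p this] show ?case by (auto simp: token_reply_def split: prod.splits)
  qed
  have move: "president_move (st p n) (p (Suc n))" if p: "lazy_walk G p" for p n
    using fst_st[OF p, of n] p by (auto simp: president_move_def lazy_walk_def split: prod.splits)
  have "team_strategy G N s"
    unfolding team_strategy_def
  proof (intro conjI allI impI)
    show "s [] i \<in> pverts G" for i using u0 by (simp add: s_def)
    fix p n i assume p: "lazy_walk G p" and i: "i < N"
    show "lazy_step G (team_position s p n i) (team_position s p (Suc n) i)"
    proof (cases n)
      case 0
      then show ?thesis
        using st0[OF p] u0 unfolding pos by (simp add: team_position_def s_def lazy_step_refl)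
    next
      case (Suc m)
      then show ?thesis
        using st_reply[OF p move[OF p], of m] i unfolding Suc pos
        by (auto simp: token_reply_def split: prod.splits)
    qed
  qed
  moreover have "\<exists>T. \<forall>t\<ge>T. surrounded G N (team_position s p (Suc t)) (p t)"
    if p: "lazy_walk G p" for p
  proof -
    have "\<exists>T. \<forall>t\<ge>T. st p t \<in> caught k"
      using \<sigma>[of "p 0"] move[OF p] p unfolding st_def winning_from_def lazy_walk_def by blast
    moreover have "surrounded G N (team_position s p (Suc t)) (p t)" if "st p t \<in> caught k" for t
      using caught_surrounded[of "p t" "fst (snd (st p t))" "snd (snd (st p t))"] that
        fst_st[OF p, of t] pos[of p t] by (metis prod.collapse)
    ultimately show ?thesis by blast
  qed
  ultimately show ?thesis unfolding bodyguards_win_def by blast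
qed

end

section \<open>The bound for Cartesian products\<close>

lemma cops_win_imp_pos:
  assumes "cops_win G c" "pverts G \<noteq> {}"
  shows "0 < c"
proof -
  obtain u where "u \<in> pverts G" using assms(2) by blast
  then have "lazy_walk G (\<lambda>_. u)" by (simp add: lazy_walk_def lazy_step_refl)
  then show ?thesis using assms(1) unfolding cops_win_def by fastforce
qed

theorem theorem4p1:
  fixes G :: "'a pair_pre_digraph" and H :: "'b pair_pre_digraph"
  assumes "pair_graph G" and "connected (with_proj G)"
    and "pair_graph H" and "connected (with_proj H)"
  shows "int (bodyguard_number (G \<box> H)) \<le>
    int (bodyguard_number G) + int (bodyguard_number H) + int (cop_number (G \<box> H)) - 1"
proof -
  let ?c = "cop_number (G \<box> H)" and ?k = "bodyguard_number G" and ?l = "bodyguard_number H"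
  have conG: "lazy_connected G" and conH: "lazy_connected H"
    using assms connected_imp_lazy_connected by blast+
  then have con: "lazy_connected (G \<box> H)" by (rule lazy_connected_cartesian_product)
  have "bodyguards_win G ?k" "bodyguards_win H ?l"
    using assms bodyguards_win_card unfolding bodyguard_number_def by (metis LeastI)+
  then obtain S T where "guarding G ?k S" "guarding H ?l T"
    using conG conH bodyguards_win_imp_guarding by metis
  then obtain U where U: "guarding (G \<box> H) (?k + ?l) U"
    using guarding_cartesian_product by blast
  have cops: "cops_win (G \<box> H) ?c"
    using cops_win_card[OF pair_graph_cartesian_product] assms
    unfolding cop_number_def by (metis LeastI)
  \<comment> \<open>Positivity makes the truncated subtraction in \<open>?k + ?l + ?c - 1\<close>
    agree with the integer one.\<close>
  have pos: "0 < ?c"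
    using cops_win_imp_pos[OF cops] con by (simp add: lazy_connected_def)
  interpret escort "G \<box> H" "?k + ?l" U "?k + ?l + ?c - 1"
    by unfold_locales (fact U)
  have "bodyguards_win (G \<box> H) (?k + ?l + ?c - 1)"
    using bodyguards_win[OF cops con] by simp
  then have "bodyguard_number (G \<box> H) \<le> ?k + ?l + ?c - 1"
    unfolding bodyguard_number_def by (rule Least_le)
  with pos show ?thesis by linarith
qed

end
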